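(* Let $D\subset\mathbb{R}$ be open, let $z\in D$ be a simple zero of a function $f:D\to\mathbb{R}$ that is sufficiently smooth in a neighborhood of $z$, let $k\ge0$ be an integer, and let $h$ be a step function at $z$ (of index $k$). Define $$\phi_k(x)=f^{(1)}(x)+\frac{f^{(2)}(x)}{2!}h(x)+\frac{f^{(3)}(x)}{3!}h(x)^2+\cdots+\frac{f^{(k+1)}(x)}{(k+1)!}h(x)^k .$$ Then $\phi_k$ is a model function (of index $k$), and the map $t_k(x)=x-[\phi_k(x)]^{-1}f(x)$ has local order of convergence at least $k+2$ at $z$.
   Context: Notation: $g^{(i)}$ is the $i$-th derivative of $g$, with $g^{(0)}=g$; $[\,\cdot\,]^{-1}$ denotes the reciprocal. A zero $z$ of $f$ is simple if $f(z)=0$ and $f^{(1)}(z)\neq0$. "Sufficiently smooth" means having as many continuous derivatives near $z$ as needed (read it as $C^\infty$ in a neighborhood of $z$). Step function (of index $k$) at $z$: a function $h$, sufficiently smooth in a neighborhood of $z$, with $h(z)=0$, $h^{(1)}(z)=-1$, and $h^{(i)}(z)=0$ for $i=2,3,\ldots,k$. Model function (of index $k$): a function $\phi$, sufficiently smooth in a neighborhood of $z$, with $\phi^{(i)}(z)=\dfrac{f^{(i+1)}(z)}{i+1}$ for $i=0,1,\ldots,k$. Order of convergence: a map $t$ with $t(z)=z$ has order of convergence $p\ge 1$ at $z$ if $\lim_{x\to z}|z-t(x)|/|z-x|^p=c$ for some constant $c>0$. "Order of convergence at least $q$" means that there are a constant $C\ge0$ and a neighborhood of $z$ on which $t$ is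 defined and $|t(x)-z|\le C|x-z|^{q}$. *)

theory Defs
  imports "HOL-Analysis.Analysis"
begin

text \<open>
  A partial real function is modelled by a total function together with its domain
  \<open>S :: real set\<close>; its values outside \<open>S\<close> are irrelevant.  Its \<open>i\<close>-th derivative is
  \<open>(deriv ^^ i) g\<close>.
\<close>

text \<open>\<open>C\<^sup>\<infinity>\<close> in a neighbourhood of \<open>z\<close>. Continuity of every derivative on \<open>U\<close> follows from
  differentiability of every derivative there.\<close>

definition smooth_near :: "real set \<Rightarrow> (real \<Rightarrow> real) \<Rightarrow> real \<Rightarrow> bool" where
  "smooth_near S g z \<longleftrightarrow>
     (\<exists>U. open U \<and> z \<in> U \<and> U \<subseteq> S \<and> (\<forall>i. \<forall>x\<in>U. (deriv ^^ i) g differentiable (at x)))"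

text \<open>The set of points at which the \<open>n\<close>-th derivative of \<open>g\<close> (with domain \<open>S\<close>) exists.
  Since \<open>deriv\<close> is total, existence of the lower derivatives nearby must be required explicitly.\<close>

primrec deriv_dom :: "real set \<Rightarrow> (real \<Rightarrow> real) \<Rightarrow> nat \<Rightarrow> real set" where
  "deriv_dom S g 0 = S"
| "deriv_dom S g (Suc n) =
     {x \<in> interior (deriv_dom S g n). (deriv ^^ n) g differentiable (at x)}"

definition simple_zero :: "(real \<Rightarrow> real) \<Rightarrow> real \<Rightarrow> bool" where
  "simple_zero f z \<longleftrightarrow> f z = 0 \<and> deriv f z \<noteq> 0"

definition step_function :: "nat \<Rightarrow> real set \<Rightarrow> (real \<Rightarrow> real) \<Rightarrow> real \<Rightarrow> bool" where
  "step_function k S h z \<longleftrightarrow>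
     smooth_near S h z \<and> h z = 0 \<and> deriv h z = -1 \<and> (\<forall>i\<in>{2..k}. (deriv ^^ i) h z = 0)"

definition model_function ::
  "nat \<Rightarrow> (real \<Rightarrow> real) \<Rightarrow> real set \<Rightarrow> (real \<Rightarrow> real) \<Rightarrow> real \<Rightarrow> bool" where
  "model_function k f S \<phi> z \<longleftrightarrow>
     smooth_near S \<phi> z \<and> (\<forall>i\<le>k. (deriv ^^ i) \<phi> z = (deriv ^^ (i + 1)) f z / real (i + 1))"

definition order_at_least :: "nat \<Rightarrow> real set \<Rightarrow> (real \<Rightarrow> real) \<Rightarrow> real \<Rightarrow> bool" where
  "order_at_least q S t z \<longleftrightarrow>
     (\<exists>C\<ge>0. \<exists>U. open U \<and> z \<in> U \<and> U \<subseteq> S \<and> (\<forall>x\<in>U. \<bar>t x - z\<bar> \<le> C * \<bar>x - z\<bar> ^ q))"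

definition phi :: "(real \<Rightarrow> real) \<Rightarrow> (real \<Rightarrow> real) \<Rightarrow> nat \<Rightarrow> real \<Rightarrow> real" where
  "phi f h k x = (\<Sum>j\<le>k. (deriv ^^ (j + 1)) f x / fact (j + 1) * h x ^ j)"

definition phi_dom :: "real set \<Rightarrow> (real \<Rightarrow> real) \<Rightarrow> real set \<Rightarrow> nat \<Rightarrow> real set" where
  "phi_dom D f E k = deriv_dom D f (k + 1) \<inter> E"

definition t_map :: "(real \<Rightarrow> real) \<Rightarrow> (real \<Rightarrow> real) \<Rightarrow> nat \<Rightarrow> real \<Rightarrow> real" where
  "t_map f h k x = x - inverse (phi f h k x) * f x"

text \<open>The reciprocal must exist; recall \<open>inverse 0 = 0\<close>.\<close>

definition t_dom ::
  "real set \<Rightarrow> (real \<Rightarrow> real) \<Rightarrow> real set \<Rightarrow> (real \<Rightarrow> real) \<Rightarrow> nat \<Rightarrow> real set" where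
  "t_dom D f E h k = {x \<in> phi_dom D f E k. phi f h k x \<noteq> 0}"

end

theory Submission
  imports Defs
begin

text \<open>
  Expanding \<open>f\<close> at \<open>x\<close> and evaluating at \<open>z\<close> gives
  \<open>0 = f z = f x + (z - x) \<psi> x + O((x - z)\<^sup>k\<^sup>+\<^sup>2)\<close>, where \<open>\<psi>\<close> is \<open>\<phi>\<^sub>k\<close> with \<open>h x\<close>
  replaced by \<open>z - x\<close>. A step function is \<open>z - x\<close> up to \<open>O((x - z)\<^sup>k\<^sup>+\<^sup>1)\<close>, so the same
  holds for \<open>\<phi>\<^sub>k\<close>: \<open>f x - (x - z) \<phi>\<^sub>k x = O((x - z)\<^sup>k\<^sup>+\<^sup>2)\<close>. Dividing by \<open>\<phi>\<^sub>k x\<close> yields the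
  order of convergence; comparing Taylor coefficients at \<open>z\<close> yields
  \<open>f\<^sup>(\<^sup>i\<^sup>+\<^sup>1\<^sup>) z = (i + 1) \<phi>\<^sub>k\<^sup>(\<^sup>i\<^sup>) z\<close> for \<open>i \<le> k\<close>.
\<close>

section \<open>Iterated derivatives on open sets\<close>

lemma deriv_cong_open:
  fixes f g :: "real \<Rightarrow> real"
  assumes "open U" "x \<in> U" "\<And>y. y \<in> U \<Longrightarrow> f y = g y"
  shows "deriv f x = deriv g x"
  by (rule deriv_cong_ev) (use assms in \<open>auto simp: eventually_nhds\<close>)

lemma higher_deriv_cong_open:
  fixes f g :: "real \<Rightarrow> real"
  assumes "open U" "x \<in> U" "\<And>y. y \<in> U \<Longrightarrow> f y = g y"
  shows "(deriv ^^ n) f x = (deriv ^^ n) g x"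
  using assms(2)
proof (induction n arbitrary: x)
  case (Suc n)
  then show ?case by (auto intro: deriv_cong_open[OF assms(1)])
qed (use assms in auto)

lemma differentiable_cong_open:
  fixes f g :: "real \<Rightarrow> real"
  assumes "open U" "x \<in> U" "\<And>y. y \<in> U \<Longrightarrow> f y = g y" "f differentiable (at x)"
  shows "g differentiable (at x)"
  using assms has_derivative_transform_within_open unfolding differentiable_def by metis

lemma differentiable_iff_deriv:
  fixes f :: "real \<Rightarrow> real"
  shows "f differentiable (at x) \<longleftrightarrow> (f has_real_derivative deriv f x) (at x)"
  using DERIV_deriv_iff_real_differentiable by blast

section \<open>Finite orders of differentiability and their closure under sums and products\<close>

definition times_differentiable_on :: "nat \<Rightarrow> real set \<Rightarrow> (real \<Rightarrow> real) \<Rightarrow> bool" where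
  "times_differentiable_on n U g \<longleftrightarrow> (\<forall>i<n. \<forall>x\<in>U. (deriv ^^ i) g differentiable (at x))"

lemma times_differentiable_on_0 [simp]: "times_differentiable_on 0 U g"
  by (simp add: times_differentiable_on_def)

text \<open>Peels off the innermost derivative, so that the closure proofs can induct on
  \<open>n\<close> with the functions generalised.\<close>

lemma times_differentiable_on_Suc:
  "times_differentiable_on (Suc n) U g \<longleftrightarrow>
     (\<forall>x\<in>U. g differentiable (at x)) \<and> times_differentiable_on n U (deriv g)"
  by (auto simp: times_differentiable_on_def All_less_Suc2 funpow_swap1)

lemma times_differentiable_on_SucD:
  "times_differentiable_on (Suc n) U g \<Longrightarrow> times_differentiable_on n U g"
  by (simp add: times_differentiable_on_def)

text \<open>Derivatives on an open set depend only on the values there. Hence the sum and product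
  rules, known only on \<open>U\<close>, may replace \<open>deriv\<close> of a sum or
  product.\<close>

lemma times_differentiable_on_cong:
  assumes "open U" "\<And>x. x \<in> U \<Longrightarrow> f x = g x" "times_differentiable_on n U f"
  shows "times_differentiable_on n U g"
proof -
  have "(deriv ^^ i) g differentiable (at x)" if "i < n" "x \<in> U" for i x
  proof (rule differentiable_cong_open[OF assms(1) that(2)])
    show "(deriv ^^ i) f y = (deriv ^^ i) g y" if "y \<in> U" for y
      using assms(1) that assms(2) by (rule higher_deriv_cong_open)
    show "(deriv ^^ i) f differentiable (at x)"
      using assms(3) that by (simp add: times_differentiable_on_def)
  qed
  then show ?thesis by (simp add: times_differentiable_on_def)
qed

lemma times_differentiable_on_const: "times_differentiable_on n U (\<lambda>x. c)"
  by (induction n arbitrary: c) (auto simp: times_differentiable_on_Suc)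

lemma times_differentiable_on_add:
  assumes "open U" "times_differentiable_on n U f" "times_differentiable_on n U g"
  shows "times_differentiable_on n U (\<lambda>x. f x + g x)"
  using assms(2,3)
proof (induction n arbitrary: f g)
  case (Suc n)
  have "deriv f x + deriv g x = deriv (\<lambda>x. f x + g x) x" if "x \<in> U" for x
    by (rule DERIV_imp_deriv[symmetric], rule DERIV_add)
      (use Suc.prems that in \<open>auto simp: times_differentiable_on_Suc differentiable_iff_deriv\<close>)
  moreover have "times_differentiable_on n U (\<lambda>x. deriv f x + deriv g x)"
    using Suc by (simp add: times_differentiable_on_Suc)
  ultimately have "times_differentiable_on n U (deriv (\<lambda>x. f x + g x))"
    by (rule times_differentiable_on_cong[OF assms(1)])
  then show ?case using Suc.prems by (auto simp: times_differentiable_on_Suc)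
qed auto

lemma times_differentiable_on_mult:
  assumes "open U" "times_differentiable_on n U f" "times_differentiable_on n U g"
  shows "times_differentiable_on n U (\<lambda>x. f x * g x)"
  using assms(2,3)
proof (induction n arbitrary: f g)
  case (Suc n)
  have "deriv f x * g x + deriv g x * f x = deriv (\<lambda>x. f x * g x) x" if "x \<in> U" for x
    by (rule DERIV_imp_deriv[symmetric], rule DERIV_mult)
      (use Suc.prems that in \<open>auto simp: times_differentiable_on_Suc differentiable_iff_deriv\<close>)
  \<comment> \<open>The product rule brings back \<open>f\<close> and \<open>g\<close> themselves;
    they have one order to spare, so the induction hypothesis covers both products.\<close>
  moreover have "times_differentiable_on n U (\<lambda>x. deriv f x * g x + deriv g x * f x)"
    using Suc times_differentiable_on_SucD[of n U f] times_differentiable_on_SucD[of n U g]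
    by (intro times_differentiable_on_add assms(1)) (simp_all add: times_differentiable_on_Suc)
  ultimately have "times_differentiable_on n U (deriv (\<lambda>x. f x * g x))"
    by (rule times_differentiable_on_cong[OF assms(1)])
  then show ?case using Suc.prems by (auto simp: times_differentiable_on_Suc)
qed auto

section \<open>Smooth functions on a fixed set\<close>

definition infinitely_differentiable_on :: "real set \<Rightarrow> (real \<Rightarrow> real) \<Rightarrow> bool" where
  "infinitely_differentiable_on U g \<longleftrightarrow> (\<forall>i. \<forall>x\<in>U. (deriv ^^ i) g differentiable (at x))"

lemma infinitely_differentiable_on_iff:
  "infinitely_differentiable_on U g \<longleftrightarrow> (\<forall>n. times_differentiable_on n U g)"
  by (auto simp: infinitely_differentiable_on_def times_differentiable_on_def)

lemma smooth_near_iff: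
  "smooth_near S g z \<longleftrightarrow> (\<exists>U. open U \<and> z \<in> U \<and> U \<subseteq> S \<and> infinitely_differentiable_on U g)"
  by (simp add: smooth_near_def infinitely_differentiable_on_def)

lemma infinitely_differentiable_on_subset:
  "infinitely_differentiable_on U g \<Longrightarrow> V \<subseteq> U \<Longrightarrow> infinitely_differentiable_on V g"
  by (auto simp: infinitely_differentiable_on_def)

lemma infinitely_differentiable_on_const: "infinitely_differentiable_on U (\<lambda>x. c)"
  by (simp add: infinitely_differentiable_on_iff times_differentiable_on_const)

lemma infinitely_differentiable_on_ident: "infinitely_differentiable_on U (\<lambda>x. x)"
proof -
  have "times_differentiable_on n U (\<lambda>x. x)" for n
    by (cases n) (auto simp: times_differentiable_on_Suc times_differentiable_on_const)
  then show ?thesis by (simp add: infinitely_differentiable_on_iff)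
qed

lemma infinitely_differentiable_on_add:
  "open U \<Longrightarrow> infinitely_differentiable_on U f \<Longrightarrow> infinitely_differentiable_on U g
    \<Longrightarrow> infinitely_differentiable_on U (\<lambda>x. f x + g x)"
  by (simp add: infinitely_differentiable_on_iff times_differentiable_on_add)

lemma infinitely_differentiable_on_mult:
  "open U \<Longrightarrow> infinitely_differentiable_on U f \<Longrightarrow> infinitely_differentiable_on U g
    \<Longrightarrow> infinitely_differentiable_on U (\<lambda>x. f x * g x)"
  by (simp add: infinitely_differentiable_on_iff times_differentiable_on_mult)

lemma infinitely_differentiable_on_power:
  assumes "open U" "infinitely_differentiable_on U f"
  shows "infinitely_differentiable_on U (\<lambda>x. f x ^ n)"
  using assms
  by (induction n)
    (auto intro: infinitely_differentiable_on_const infinitely_differentiable_on_mult)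

lemma infinitely_differentiable_on_sum:
  assumes "open U" "\<And>i. i \<in> I \<Longrightarrow> infinitely_differentiable_on U (f i)"
  shows "infinitely_differentiable_on U (\<lambda>x. \<Sum>i\<in>I. f i x)"
  using assms
  by (induction I rule: infinite_finite_induct)
    (auto intro: infinitely_differentiable_on_const infinitely_differentiable_on_add)

lemma infinitely_differentiable_on_higher_deriv:
  "infinitely_differentiable_on U f \<Longrightarrow> infinitely_differentiable_on U ((deriv ^^ m) f)"
  unfolding infinitely_differentiable_on_def
  by (metis comp_apply funpow_add)

lemma infinitely_differentiable_on_DERIV:
  "infinitely_differentiable_on U f \<Longrightarrow> x \<in> U
    \<Longrightarrow> ((deriv ^^ i) f has_real_derivative (deriv ^^ Suc i) f x) (at x)"
  by (simp add: infinitely_differentiable_on_def differentiable_iff_deriv)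

lemma infinitely_differentiable_on_isCont:
  "infinitely_differentiable_on U f \<Longrightarrow> x \<in> U \<Longrightarrow> isCont f x"
  using infinitely_differentiable_on_DERIV[of U f x 0] DERIV_isCont by fastforce

text \<open>Leibniz rule in which only two terms survive, since \<open>x - a\<close> has no higher
  derivatives. At \<open>x = a\<close> one term is left, and its factor \<open>Suc n\<close> becomes
  the denominator \<open>i + 1\<close> of a model function.\<close>

lemma higher_deriv_linear_factor:
  assumes "open U" "infinitely_differentiable_on U g" "x \<in> U"
  shows "(deriv ^^ Suc n) (\<lambda>x. (x - a) * g x) x =
           (x - a) * (deriv ^^ Suc n) g x + real (Suc n) * (deriv ^^ n) g x"
  using assms(3)
proof (induction n arbitrary: x)
  case 0
  show ?case
    using infinitely_differentiable_on_DERIV[OF assms(2) 0, of 0]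
    by (auto intro!: DERIV_imp_deriv derivative_eq_intros)
next
  case (Suc n)
  have "(deriv ^^ Suc (Suc n)) (\<lambda>x. (x - a) * g x) x =
      deriv (\<lambda>x. (x - a) * (deriv ^^ Suc n) g x + real (Suc n) * (deriv ^^ n) g x) x"
    unfolding funpow.simps(2)[of "Suc n"] comp_apply
    by (rule deriv_cong_open[OF assms(1) Suc.prems Suc.IH])
  also have "\<dots> = (x - a) * (deriv ^^ Suc (Suc n)) g x + real (Suc (Suc n)) * (deriv ^^ Suc n) g x"
    using infinitely_differentiable_on_DERIV[OF assms(2) Suc.prems, of n]
      infinitely_differentiable_on_DERIV[OF assms(2) Suc.prems, of "Suc n"]
    by (intro DERIV_imp_deriv)
      (auto intro!: derivative_eq_intros simp: algebra_simps simp del: funpow.simps)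
  finally show ?case .
qed

text \<open>An open set survives the interior taken at each stage of
  \<open>deriv_dom\<close>.\<close>

lemma subset_deriv_dom:
  assumes "open U" "U \<subseteq> S" "infinitely_differentiable_on U f"
  shows "U \<subseteq> deriv_dom S f n"
proof (induction n)
  case (Suc n)
  then have "U \<subseteq> interior (deriv_dom S f n)"
    using assms(1) by (simp add: interior_maximal)
  then show ?case
    using assms(3) by (auto simp: infinitely_differentiable_on_def)
qed (use assms in simp)

section \<open>Taylor expansion with Landau remainder\<close>

text \<open>Lagrange remainder with the \<open>n\<close>-th derivative bounded by compactness. The
  bound is uniform in the centre \<open>x\<close> and the point \<open>y\<close>, so either may
  later be set to \<open>z\<close>.\<close>

lemma Taylor_remainder_bound:
  assumes "open U" "infinitely_differentiable_on U f" "z \<in> U" "0 < n"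
  obtains C e where "0 < e"
    "\<And>x y. x \<in> cball z e \<Longrightarrow> y \<in> cball z e \<Longrightarrow>
       \<bar>f y - (\<Sum>m<n. (deriv ^^ m) f x / fact m * (y - x) ^ m)\<bar> \<le> C * \<bar>y - x\<bar> ^ n"
proof -
  obtain e where e: "e > 0" "cball z e \<subseteq> U"
    using assms open_contains_cball by blast
  have "continuous_on (cball z e) ((deriv ^^ n) f)"
    using e(2) assms(2)
    by (intro continuous_at_imp_continuous_on)
      (auto intro: infinitely_differentiable_on_isCont infinitely_differentiable_on_higher_deriv)
  then have "bounded ((deriv ^^ n) f ` cball z e)"
    by (intro compact_imp_bounded compact_continuous_image) auto
  then obtain B where B: "\<And>t. t \<in> cball z e \<Longrightarrow> \<bar>(deriv ^^ n) f t\<bar> \<le> B"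
    unfolding bounded_iff by (metis image_eqI real_norm_def)
  have "\<bar>f y - (\<Sum>m<n. (deriv ^^ m) f x / fact m * (y - x) ^ m)\<bar> \<le> B / fact n * \<bar>y - x\<bar> ^ n"
    if xy: "x \<in> cball z e" "y \<in> cball z e" for x y
  \<comment> \<open>\<open>Taylor\<close> needs distinct points. For \<open>x = y\<close> only the
    term \<open>m = 0\<close> survives, and it is present because \<open>0 < n\<close>.\<close>
  proof (cases "x = y")
    case True
    then show ?thesis using \<open>0 < n\<close> by (cases n) (simp_all add: sum.lessThan_Suc_shift del: sum.lessThan_Suc)
  next
    case False
    have "\<forall>m t. m < n \<and> z - e \<le> t \<and> t \<le> z + e \<longrightarrow>
        ((deriv ^^ m) f has_real_derivative (deriv ^^ Suc m) f t) (at t)"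
      using e(2) assms(2) infinitely_differentiable_on_DERIV
      by (metis atLeastAtMost_iff cball_eq_atLeastAtMost subsetD)
    then obtain t where t: "if y < x then y < t \<and> t < x else x < t \<and> t < y"
      "f y = (\<Sum>m<n. (deriv ^^ m) f x / fact m * (y - x) ^ m) + (deriv ^^ n) f t / fact n * (y - x) ^ n"
      using Taylor[of n "\<lambda>m. (deriv ^^ m) f" f "z - e" "z + e" x y] xy False \<open>0 < n\<close>
      by (auto simp: cball_eq_atLeastAtMost)
    have "t \<in> cball z e"
      using t(1) xy by (auto simp: cball_eq_atLeastAtMost split: if_splits)
    from B[OF this] show ?thesis
      by (subst t(2)) (auto simp: abs_mult power_abs intro!: mult_right_mono divide_right_mono)
  qed
  with e(1) show thesis by (rule that)
qed

text \<open>The filter is \<open>nhds z\<close> rather than \<open>at z\<close>: the bound in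
  \<open>order_at_least\<close> must hold at \<open>z\<close> as well.\<close>

lemma bigo_nhdsI:
  fixes f g :: "real \<Rightarrow> real"
  assumes "e > 0" "\<And>x. x \<in> cball z e \<Longrightarrow> \<bar>f x\<bar> \<le> C * \<bar>g x\<bar>"
  shows "f \<in> O[nhds z](g)"
proof (rule bigoI)
  have "eventually (\<lambda>x. x \<in> ball z e) (nhds z)"
    using assms(1) by (intro eventually_nhds_in_open) auto
  then show "eventually (\<lambda>x. norm (f x) \<le> C * norm (g x)) (nhds z)"
    by eventually_elim (use assms(2) in auto)
qed

lemma Taylor_bigo:
  assumes "open U" "infinitely_differentiable_on U f" "z \<in> U" "0 < n"
  shows "(\<lambda>x. f x - (\<Sum>m<n. (deriv ^^ m) f z / fact m * (x - z) ^ m)) \<in> O[nhds z](\<lambda>x. (x - z) ^ n)"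
proof (rule Taylor_remainder_bound[OF assms])
  fix C e :: real
  assume "0 < e" and bound: "\<And>x y. x \<in> cball z e \<Longrightarrow> y \<in> cball z e \<Longrightarrow>
       \<bar>f y - (\<Sum>m<n. (deriv ^^ m) f x / fact m * (y - x) ^ m)\<bar> \<le> C * \<bar>y - x\<bar> ^ n"
  show ?thesis
  proof (rule bigo_nhdsI[OF \<open>0 < e\<close>])
    fix x assume "x \<in> cball z e"
    moreover have "z \<in> cball z e" using \<open>0 < e\<close> by simp
    ultimately show "\<bar>f x - (\<Sum>m<n. (deriv ^^ m) f z / fact m * (x - z) ^ m)\<bar> \<le> C * \<bar>(x - z) ^ n\<bar>"
      using bound[of z x] by (simp only: power_abs)
  qed
qed

text \<open>Here the derivatives are taken at the variable point \<open>x\<close>, as in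
  \<open>phi\<close>, and the expansion is evaluated at \<open>z\<close>.\<close>

lemma Taylor_bigo_moving_centre:
  assumes "open U" "infinitely_differentiable_on U f" "z \<in> U" "0 < n"
  shows "(\<lambda>x. f z - (\<Sum>m<n. (deriv ^^ m) f x / fact m * (z - x) ^ m)) \<in> O[nhds z](\<lambda>x. (x - z) ^ n)"
proof (rule Taylor_remainder_bound[OF assms])
  fix C e :: real
  assume "0 < e" and bound: "\<And>x y. x \<in> cball z e \<Longrightarrow> y \<in> cball z e \<Longrightarrow>
       \<bar>f y - (\<Sum>m<n. (deriv ^^ m) f x / fact m * (y - x) ^ m)\<bar> \<le> C * \<bar>y - x\<bar> ^ n"
  show ?thesis
  proof (rule bigo_nhdsI[OF \<open>0 < e\<close>])
    fix x assume "x \<in> cball z e"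
    moreover have "z \<in> cball z e" using \<open>0 < e\<close> by simp
    ultimately show "\<bar>f z - (\<Sum>m<n. (deriv ^^ m) f x / fact m * (z - x) ^ m)\<bar> \<le> C * \<bar>(x - z) ^ n\<bar>"
      using bound[of x z] by (simp only: power_abs abs_minus_commute[of x z])
  qed
qed

lemma isCont_imp_bigo_1:
  fixes f :: "real \<Rightarrow> real"
  assumes "isCont f z"
  shows "f \<in> O[nhds z](\<lambda>x. 1)"
proof -
  have "(f \<longlongrightarrow> f z) (nhds z)"
    using assms by (simp add: isCont_def tendsto_at_iff_tendsto_nhds)
  then have "eventually (\<lambda>x. dist (f x) (f z) < 1) (nhds z)"
    by (rule tendstoD) simp
  then have "eventually (\<lambda>x. norm (f x) \<le> (\<bar>f z\<bar> + 1) * norm (1::real)) (nhds z)"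
    by eventually_elim (auto simp: dist_real_def)
  then show ?thesis by (rule bigoI)
qed

section \<open>Uniqueness of Taylor coefficients\<close>

lemma bigo_power_antimono:
  fixes z :: real
  assumes "m \<le> n"
  shows "(\<lambda>x. (x - z) ^ n) \<in> O[nhds z](\<lambda>x. (x - z) ^ m)"
proof -
  have "(\<lambda>x. (x - z) ^ (n - m) * (x - z) ^ m) \<in> O[nhds z](\<lambda>x. 1 * (x - z) ^ m)"
    by (intro landau_o.big.mult isCont_imp_bigo_1 continuous_intros) auto
  then show ?thesis using assms by (simp flip: power_add)
qed

text \<open>The top term has order \<open>n\<close> by itself, so the induction hypothesis kills all
  lower coefficients. The top term alone is then of order \<open>n + 1\<close>; cancelling
  \<open>(x - z) ^ n\<close> and letting \<open>x\<close> tend to \<open>z\<close> kills its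
  coefficient.\<close>

lemma polynomial_bigo_imp_coeffs_0:
  fixes c :: "nat \<Rightarrow> real"
  assumes "(\<lambda>x. \<Sum>m<n. c m * (x - z) ^ m) \<in> O[nhds z](\<lambda>x. (x - z) ^ n)" "m < n"
  shows "c m = 0"
  using assms
proof (induction n arbitrary: m)
  case (Suc n)
  have "(\<lambda>x. \<Sum>m<Suc n. c m * (x - z) ^ m) \<in> O[nhds z](\<lambda>x. (x - z) ^ n)"
    by (rule landau_o.big_trans[OF Suc.prems(1) bigo_power_antimono]) simp
  moreover have "(\<lambda>x. c n * (x - z) ^ n) \<in> O[nhds z](\<lambda>x. (x - z) ^ n)"
    by simp
  ultimately have "(\<lambda>x. (\<Sum>m<Suc n. c m * (x - z) ^ m) - c n * (x - z) ^ n) \<in> O[nhds z](\<lambda>x. (x - z) ^ n)"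
    by (rule sum_in_bigo)
  then have low: "c m = 0" if "m < n" for m
    using Suc.IH that by simp
  then have "(\<lambda>x. c n * (x - z) ^ n) \<in> O[nhds z](\<lambda>x. (x - z) ^ Suc n)"
    using Suc.prems(1) by simp
  then obtain C where "eventually (\<lambda>x. norm (c n * (x - z) ^ n) \<le> C * norm ((x - z) ^ Suc n)) (nhds z)"
    by (elim landau_o.bigE)
  \<comment> \<open>The point \<open>z\<close> is removed so that the power of \<open>x - z\<close>
    can be cancelled.\<close>
  then have "eventually (\<lambda>x. norm (c n * (x - z) ^ n) \<le> C * norm ((x - z) ^ Suc n)) (at z)"
    using eventually_nhds_conv_at by blast
  moreover have "eventually (\<lambda>x. x \<noteq> z) (at z)"
    by (rule eventually_neq_at_within)
  ultimately have "eventually (\<lambda>x. \<bar>c n\<bar> \<le> C * \<bar>x - z\<bar>) (at z)"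
  proof eventually_elim
    case (elim x)
    then have "\<bar>x - z\<bar> ^ n * \<bar>c n\<bar> \<le> \<bar>x - z\<bar> ^ n * (C * \<bar>x - z\<bar>)"
      by (simp add: abs_mult power_abs mult_ac)
    with elim show ?case by (simp add: mult_le_cancel_left_pos)
  qed
  moreover have "((\<lambda>x. C * \<bar>x - z\<bar>) \<longlongrightarrow> C * \<bar>z - z\<bar>) (at z)"
    by (intro tendsto_intros)
  ultimately have "\<bar>c n\<bar> \<le> C * \<bar>z - z\<bar>"
    by (intro tendsto_lowerbound) auto
  then have "c n = 0" by simp
  with low Suc.prems(2) show ?case by (metis less_Suc_eq)
next
  case 0
  from \<open>m < 0\<close> show ?case by simp
qed

lemma higher_deriv_eq_if_bigo:
  assumes "open U" "z \<in> U" "infinitely_differentiable_on U f" "infinitely_differentiable_on U g"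
    and "(\<lambda>x. f x - g x) \<in> O[nhds z](\<lambda>x. (x - z) ^ n)" "m < n"
  shows "(deriv ^^ m) f z = (deriv ^^ m) g z"
proof -
  let ?T = "\<lambda>f x. \<Sum>m<n. (deriv ^^ m) f z / fact m * (x - z) ^ m"
  have "0 < n" using assms(6) by simp
  \<comment> \<open>The functions cancel and leave the difference of the two Taylor
    polynomials.\<close>
  have "(\<lambda>x. (f x - g x) - (f x - ?T f x) + (g x - ?T g x)) \<in> O[nhds z](\<lambda>x. (x - z) ^ n)"
    by (intro sum_in_bigo assms(5) Taylor_bigo[OF assms(1) _ assms(2) \<open>0 < n\<close>] assms(3,4))
  also have "(\<lambda>x. (f x - g x) - (f x - ?T f x) + (g x - ?T g x)) =
      (\<lambda>x. \<Sum>m<n. ((deriv ^^ m) f z / fact m - (deriv ^^ m) g z / fact m) * (x - z) ^ m)"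
    by (simp add: left_diff_distrib sum_subtractf)
  finally have "(deriv ^^ m) f z / fact m - (deriv ^^ m) g z / fact m = 0"
    by (rule polynomial_bigo_imp_coeffs_0) (rule assms(6))
  then show ?thesis by simp
qed

section \<open>Step and model functions\<close>

text \<open>The Taylor polynomial of \<open>h\<close> of degree \<open>k\<close> is exactly
  \<open>z - x\<close>, which settles \<open>j = 1\<close>. For other positive \<open>j\<close>, the
  difference of \<open>j\<close>-th powers is \<open>h x - (z - x)\<close> times a factor bounded
  near \<open>z\<close>.\<close>

lemma step_function_power_bigo:
  assumes "step_function k E h z" "j \<le> k"
  shows "(\<lambda>x. h x ^ j - (z - x) ^ j) \<in> O[nhds z](\<lambda>x. (x - z) ^ (k + 1))"
proof (cases "j = 0")
  case False
  \<comment> \<open>From \<open>0 < j\<close> and \<open>j \<le> k\<close> it follows that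
    \<open>k\<close> is positive, so the expansion does contain the linear term with coefficient
    -1.\<close>
  then obtain k' where k: "k = Suc k'" using assms(2) by (cases k) auto
  obtain V where V: "open V" "z \<in> V" "infinitely_differentiable_on V h"
    using assms(1) by (auto simp: step_function_def smooth_near_iff)
  have [simp]: "h z = 0" "deriv h z = - 1"
    using assms(1) by (auto simp: step_function_def)
  have "(\<Sum>m<k'. (deriv ^^ Suc (Suc m)) h z / fact (Suc (Suc m)) * (x - z) ^ Suc (Suc m)) = 0" for x
    by (rule sum.neutral) (use assms(1) k in \<open>auto simp: step_function_def simp del: funpow.simps\<close>)
  then have "(\<Sum>m<k+1. (deriv ^^ m) h z / fact m * (x - z) ^ m) = z - x" for x
    by (simp add: k sum.lessThan_Suc_shift del: sum.lessThan_Suc)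
  then have *: "(\<lambda>x. h x - (z - x)) \<in> O[nhds z](\<lambda>x. (x - z) ^ (k + 1))"
    using Taylor_bigo[OF V(1,3,2), of "k + 1"] by simp
  have "isCont h z" using V infinitely_differentiable_on_isCont by blast
  then have "(\<lambda>x. \<Sum>i<j. (z - x) ^ (j - Suc i) * h x ^ i) \<in> O[nhds z](\<lambda>x. 1)"
    by (intro isCont_imp_bigo_1 continuous_intros)
  from landau_o.big.mult[OF * this] show ?thesis
    by (simp add: power_diff_sumr2)
qed simp

lemma infinitely_differentiable_on_phi:
  assumes "open U" "infinitely_differentiable_on U f" "infinitely_differentiable_on U h"
  shows "infinitely_differentiable_on U (phi f h k)"
proof -
  \<comment> \<open>Division by a factorial is written as multiplication by a constant, to fit the
    closure rules.\<close>
  have "infinitely_differentiable_on U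
      (\<lambda>x. \<Sum>j\<le>k. (deriv ^^ (j + 1)) f x * (1 / fact (j + 1)) * h x ^ j)"
    by (intro infinitely_differentiable_on_sum infinitely_differentiable_on_mult
        infinitely_differentiable_on_power infinitely_differentiable_on_higher_deriv
        infinitely_differentiable_on_const assms)
  then show ?thesis by (simp add: phi_def[abs_def])
qed

lemma phi_bigo:
  assumes "open U" "z \<in> U" "infinitely_differentiable_on U f" "f z = 0" "step_function k E h z"
  shows "(\<lambda>x. f x - (x - z) * phi f h k x) \<in> O[nhds z](\<lambda>x. (x - z) ^ (k + 2))"
proof -
  let ?\<psi> = "\<lambda>x. \<Sum>j\<le>k. (deriv ^^ (j + 1)) f x / fact (j + 1) * (z - x) ^ j"
  \<comment> \<open>Splitting off \<open>m = 0\<close> and shifting the index leaves a common factor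
    \<open>z - x\<close>.\<close>
  have "(\<Sum>m<k+2. (deriv ^^ m) f x / fact m * (z - x) ^ m) = f x + (z - x) * ?\<psi> x" for x
  proof -
    have "(\<Sum>m<k+2. (deriv ^^ m) f x / fact m * (z - x) ^ m) =
        f x + (\<Sum>j\<le>k. (deriv ^^ (j + 1)) f x / fact (j + 1) * (z - x) ^ (j + 1))"
      using sum.lessThan_Suc_shift[of "\<lambda>m. (deriv ^^ m) f x / fact m * (z - x) ^ m" "Suc k"]
      by (simp add: lessThan_Suc_atMost del: sum.lessThan_Suc sum.atMost_Suc fact_Suc)
    also have "\<dots> = f x + (z - x) * ?\<psi> x"
      by (simp add: sum_distrib_left mult_ac del: sum.atMost_Suc fact_Suc)
    finally show ?thesis .
  qed
  then have "(\<lambda>x. - (f x + (z - x) * ?\<psi> x)) \<in> O[nhds z](\<lambda>x. (x - z) ^ (k + 2))"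
    using Taylor_bigo_moving_centre[OF assms(1,3,2), of "k + 2"] assms(4) by simp
  then have Taylor: "(\<lambda>x. f x + (z - x) * ?\<psi> x) \<in> O[nhds z](\<lambda>x. (x - z) ^ (k + 2))"
    by (simp only: landau_o.big.uminus_in_iff)
  have "(\<lambda>x. \<Sum>j\<le>k. (deriv ^^ (j + 1)) f x / fact (j + 1) * (h x ^ j - (z - x) ^ j))
      \<in> O[nhds z](\<lambda>x. (x - z) ^ (k + 1))"
  proof (rule big_sum_in_bigo)
    fix j assume "j \<in> {..k}"
    have "isCont ((deriv ^^ (j + 1)) f) z"
      using assms infinitely_differentiable_on_isCont infinitely_differentiable_on_higher_deriv
      by blast
    then have "(\<lambda>x. (deriv ^^ (j + 1)) f x / fact (j + 1)) \<in> O[nhds z](\<lambda>x. 1)"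
      by (intro isCont_imp_bigo_1 continuous_intros) auto
    from landau_o.big.mult[OF this step_function_power_bigo[OF assms(5)]] \<open>j \<in> {..k}\<close>
    show "(\<lambda>x. (deriv ^^ (j + 1)) f x / fact (j + 1) * (h x ^ j - (z - x) ^ j))
        \<in> O[nhds z](\<lambda>x. (x - z) ^ (k + 1))"
      by simp
  qed
  also have "(\<lambda>x. \<Sum>j\<le>k. (deriv ^^ (j + 1)) f x / fact (j + 1) * (h x ^ j - (z - x) ^ j))
      = (\<lambda>x. phi f h k x - ?\<psi> x)"
    by (simp add: phi_def right_diff_distrib sum_subtractf)
  \<comment> \<open>Replacing \<open>z - x\<close> by \<open>h x\<close> costs an error of order
    \<open>k + 1\<close> only; the factor \<open>x - z\<close> supplies the missing order.\<close>
  finally have "(\<lambda>x. (x - z) * (phi f h k x - ?\<psi> x)) \<in> O[nhds z](\<lambda>x. (x - z) * (x - z) ^ (k + 1))"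
    by (intro landau_o.big.mult) simp_all
  then have "(\<lambda>x. (x - z) * (phi f h k x - ?\<psi> x)) \<in> O[nhds z](\<lambda>x. (x - z) ^ (k + 2))"
    by simp
  \<comment> \<open>The terms with \<open>?\<psi>\<close> cancel in the difference of the two
    estimates.\<close>
  from sum_in_bigo(2)[OF Taylor this] show ?thesis
    by (simp add: algebra_simps)
qed

section \<open>The model property and the order of convergence\<close>

theorem proposition2p2:
  fixes D E :: "real set" and f h :: "real \<Rightarrow> real" and z :: real and k :: nat
  assumes "open D" and "z \<in> D"
    and "smooth_near D f z"
    and "simple_zero f z"
    and "step_function k E h z"
  shows "model_function k f (phi_dom D f E k) (phi f h k) z \<and>
         order_at_least (k + 2) (t_dom D f E h k) (t_map f h k) z"
proof -
  obtain U V where U: "open U" "z \<in> U" "U \<subseteq> D" "infinitely_differentiable_on U f"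
    and V: "open V" "z \<in> V" "V \<subseteq> E" "infinitely_differentiable_on V h"
    using assms(3,5) by (auto simp: step_function_def smooth_near_iff)
  define W where "W = U \<inter> V"
  have W: "open W" "z \<in> W" "infinitely_differentiable_on W f" "infinitely_differentiable_on W h"
    using U V infinitely_differentiable_on_subset by (auto simp: W_def)
  have W_dom: "W \<subseteq> phi_dom D f E k"
    using subset_deriv_dom[OF U(1,3,4), of "k + 1"] V(3) by (auto simp: W_def phi_dom_def)
  have phi: "infinitely_differentiable_on W (phi f h k)"
    using W by (intro infinitely_differentiable_on_phi)
  have fz: "f z = 0" "deriv f z \<noteq> 0"
    using assms(4) by (auto simp: simple_zero_def)
  have bigo: "(\<lambda>x. f x - (x - z) * phi f h k x) \<in> O[nhds z](\<lambda>x. (x - z) ^ (k + 2))"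
    by (rule phi_bigo[OF W(1-3) fz(1) assms(5)])
  have coeff: "(deriv ^^ i) (phi f h k) z = (deriv ^^ (i + 1)) f z / real (i + 1)" if "i \<le> k" for i
  proof -
    \<comment> \<open>\<open>x + - z\<close> has the shape of a sum, which the closure rules
      need.\<close>
    have "infinitely_differentiable_on W (\<lambda>x. (x + - z) * phi f h k x)"
      by (intro infinitely_differentiable_on_mult infinitely_differentiable_on_add
          infinitely_differentiable_on_ident infinitely_differentiable_on_const W phi)
    then have "infinitely_differentiable_on W (\<lambda>x. (x - z) * phi f h k x)"
      by simp
    \<comment> \<open>Order \<open>k + 2\<close> gives equal derivatives up to index
      \<open>k + 1\<close>, which is exactly \<open>Suc i\<close> for
      \<open>i \<le> k\<close>.\<close>
    then have "(deriv ^^ Suc i) f z = (deriv ^^ Suc i) (\<lambda>x. (x - z) * phi f h k x) z"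
      using that by (intro higher_deriv_eq_if_bigo[OF W(1-3) _ bigo]) auto
    also have "\<dots> = real (Suc i) * (deriv ^^ i) (phi f h k) z"
      by (subst higher_deriv_linear_factor[OF W(1) phi W(2)]) simp
    finally show ?thesis by (simp del: funpow.simps)
  qed
  have model: "model_function k f (phi_dom D f E k) (phi f h k) z"
    unfolding model_function_def smooth_near_iff using W W_dom phi coeff by blast

  \<comment> \<open>The coefficient for \<open>i = 0\<close> says that \<open>phi\<close> equals
    \<open>deriv f\<close> at \<open>z\<close>, nonzero because the zero is simple.\<close>
  have phi_z: "phi f h k z \<noteq> 0" using coeff[of 0] fz by simp
  have cont: "isCont (phi f h k) z"
    using phi W(2) by (rule infinitely_differentiable_on_isCont)
  have nz: "eventually (\<lambda>x. phi f h k x \<noteq> 0) (nhds z)"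
    using cont phi_z
    by (intro tendsto_imp_eventually_ne) (simp_all add: isCont_def tendsto_at_iff_tendsto_nhds)
  \<comment> \<open>The reciprocal is continuous at \<open>z\<close>, hence bounded nearby, so
    multiplying by it keeps the order \<open>k + 2\<close>.\<close>
  have "(\<lambda>x. inverse (phi f h k x)) \<in> O[nhds z](\<lambda>x. 1)"
    using cont phi_z by (intro isCont_imp_bigo_1 continuous_intros) auto
  from landau_o.big.mult[OF this bigo]
  have "(\<lambda>x. inverse (phi f h k x) * (f x - (x - z) * phi f h k x)) \<in> O[nhds z](\<lambda>x. (x - z) ^ (k + 2))"
    by simp
  then obtain C where "C > 0"
    and C: "eventually (\<lambda>x. norm (inverse (phi f h k x) * (f x - (x - z) * phi f h k x))
              \<le> C * norm ((x - z) ^ (k + 2))) (nhds z)"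
    by (elim landau_o.bigE)
  have "eventually (\<lambda>x. x \<in> W) (nhds z)"
    using W by (intro eventually_nhds_in_open)
  with nz C have "eventually (\<lambda>x. x \<in> t_dom D f E h k \<and>
      \<bar>t_map f h k x - z\<bar> \<le> C * \<bar>x - z\<bar> ^ (k + 2)) (nhds z)"
  proof eventually_elim
    case (elim x)
    \<comment> \<open>Since \<open>phi\<close> is nonzero at \<open>x\<close>, the estimated product
      is the error of \<open>t_map\<close> up to sign.\<close>
    have "inverse (phi f h k x) * (f x - (x - z) * phi f h k x) = - (t_map f h k x - z)"
      using elim(1) by (simp add: t_map_def field_simps)
    with elim(2) have "\<bar>t_map f h k x - z\<bar> \<le> C * \<bar>x - z\<bar> ^ (k + 2)"
      by (simp only: real_norm_def abs_minus_cancel power_abs)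
    then show ?case using elim W_dom by (auto simp: t_dom_def)
  qed
  then obtain S where "open S" "z \<in> S"
    "\<And>x. x \<in> S \<Longrightarrow> x \<in> t_dom D f E h k \<and> \<bar>t_map f h k x - z\<bar> \<le> C * \<bar>x - z\<bar> ^ (k + 2)"
    unfolding eventually_nhds by blast
  then have "order_at_least (k + 2) (t_dom D f E h k) (t_map f h k) z"
    unfolding order_at_least_def using \<open>C > 0\<close>
    by (intro exI[of _ C] conjI exI[of _ S]) auto
  with model show ?thesis by simp
qed

end
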